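(* For a (connected) Eulerian digraph $G$, let $\overleftarrow{G}$ be the (Eulerian) digraph obtained by reversing the orientation of each edge. Let $v_0$ be an arbitrary vertex. Then $\lambda_{G,v_0}=\lambda_{\overleftarrow{G},v_0}$. That is, the greedoid polynomial of an Eulerian directed branching greedoid does not change if each edge is reversed.
   Context: Digraphs are finite (multi)graphs; Eulerian means in-degree equals out-degree at every vertex. For a digraph $G=(V,E)$, a tree in $G$ is a subgraph whose underlying undirected graph is connected and cycle-free. An arborescence rooted at $v_0$ is a tree $F$ containing $v_0$ in which every edge $e$ is oriented away from $v_0$ (its tail lies in the component of $F-e$ containing $v_0$). It is spanning if it contains all vertices. The directed branching greedoid of $G$ with root $v_0$ has ground set $E$, its accessible sets are the (edge sets of) arborescences rooted at $v_0$, and its bases are the spanning arborescences rooted at $v_0$. Its dual complex is the abstract simplicial complex $\mathcal{S}$ of all $S\subseteq E$ such that $E\setminus S$ contains a basis; $\dim S=|S|-1$ (so $\dim\emptyset=-1$). For a simplicial complex $\mathcal S$ of dimension $d$, the $h$-polynomial is $h(x)=f(x-1)$ where $f(y)=\sum_{S\in\mathcal{S}}y^{d-\dim S}$. The greedoid polynomial $\lambda_{G,v_0}$ is the $h$-polynomial of the dual complex. *)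

theory Defs
  imports "Graph_Theory.Digraph_Component" "HOL-Computational_Algebra.Polynomial"
begin

definition reverse_digraph :: "('a, 'b) pre_digraph \<Rightarrow> ('a, 'b) pre_digraph" where
  "reverse_digraph G =
     \<lparr> verts = verts G, arcs = arcs G, tail = head G, head = tail G \<rparr>"

definition eulerian :: "('a, 'b) pre_digraph \<Rightarrow> bool" where
  "eulerian G \<longleftrightarrow> (\<forall>v \<in> verts G. in_degree G v = out_degree G v)"

lemma fin_digraph_reverse_digraph: "fin_digraph G \<Longrightarrow> fin_digraph (reverse_digraph G)"
  by (simp add: fin_digraph_def fin_digraph_axioms_def wf_digraph_def reverse_digraph_def)

lemma eulerian_reverse_digraph: "eulerian G \<Longrightarrow> eulerian (reverse_digraph G)"
  by (simp add: eulerian_def reverse_digraph_def in_degree_def out_degree_def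
      in_arcs_def out_arcs_def)

text \<open>
  The constant \<^const>\<open>forest\<close> only excludes directed cycles, and \<^const>\<open>mk_symmetric\<close>
  merges parallel arcs, so neither describes cycles of the underlying undirected multigraph.
  For that, every arc \<open>e\<close> is replaced by its two traversals \<open>(e, True)\<close> (from tail to head)
  and \<open>(e, False)\<close> (from head to tail). An undirected cycle is a cycle of traversals that
  uses no arc twice; loops and pairs of parallel or antiparallel arcs are cycles.
\<close>

definition traversals :: "('a, 'b) pre_digraph \<Rightarrow> ('a, 'b \<times> bool) pre_digraph" where
  "traversals G =
     \<lparr> verts = verts G, arcs = arcs G \<times> UNIV,
       tail = (\<lambda>(e, fwd). if fwd then tail G e else head G e),
       head = (\<lambda>(e, fwd). if fwd then head G e else tail G e) \<rparr>"

definition undirected_cycle :: "('a, 'b) pre_digraph \<Rightarrow> ('b \<times> bool) list \<Rightarrow> bool" where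
  "undirected_cycle G p \<longleftrightarrow>
     pre_digraph.cycle (traversals G) p \<and> distinct (map fst p)"

definition undirected_tree :: "('a, 'b) pre_digraph \<Rightarrow> bool" where
  "undirected_tree F \<longleftrightarrow>
     Digraph_Component.connected F \<and> (\<nexists>p. undirected_cycle F p)"

text \<open>
  The last conjunct says that the tail of \<open>e\<close> lies in the (undirected) component of
  \<open>F - e\<close> that contains \<open>r\<close>.
\<close>

definition arborescence :: "('a, 'b) pre_digraph \<Rightarrow> 'a \<Rightarrow> bool" where
  "arborescence F r \<longleftrightarrow>
     undirected_tree F \<and> r \<in> verts F \<and>
     (\<forall>e \<in> arcs F. r \<rightarrow>\<^sup>*\<^bsub>with_proj (mk_symmetric (pre_digraph.del_arc F e))\<^esub> tail F e)"

text \<open>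
  Bases of the directed branching greedoid of \<open>G\<close> with root \<open>r\<close>; its ground set is
  \<open>arcs G\<close>.
\<close>

definition branching_bases :: "('a, 'b) pre_digraph \<Rightarrow> 'a \<Rightarrow> 'b set set" where
  "branching_bases G r = {arcs F | F. spanning F G \<and> arborescence F r}"

definition dual_complex :: "'b set \<Rightarrow> 'b set set \<Rightarrow> 'b set set" where
  "dual_complex E \<B> = {S. S \<subseteq> E \<and> (\<exists>B \<in> \<B>. B \<subseteq> E - S)}"

definition simplex_dim :: "'b set \<Rightarrow> int" where
  "simplex_dim S = int (card S) - 1"

definition complex_dim :: "'b set set \<Rightarrow> int" where
  "complex_dim \<S> = Max (simplex_dim ` \<S>)"

definition f_poly :: "'b set set \<Rightarrow> int poly" where
  "f_poly \<S> = (\<Sum>S \<in> \<S>. monom 1 (nat (complex_dim \<S> - simplex_dim S)))"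

definition h_poly :: "'b set set \<Rightarrow> int poly" where
  "h_poly \<S> = pcompose (f_poly \<S>) [:-1, 1:]"

definition greedoid_poly :: "('a, 'b) pre_digraph \<Rightarrow> 'a \<Rightarrow> int poly" where
  "greedoid_poly G r = h_poly (dual_complex (arcs G) (branching_bases G r))"

end

theory Submission
  imports Defs
begin

text \<open>
  A set of arcs contains a spanning arborescence rooted at \<open>r\<close> iff every vertex can be reached
  from \<open>r\<close> within it (\<open>ex_base_iff_root_connected\<close>). So the faces of the dual complex are the sets
  \<open>S\<close> whose complement is root-connected, and since the \<open>h\<close>-polynomial depends only on the number of
  faces of each size (\<open>h_poly_cong_card\<close>), it is enough that \<open>G\<close> and its reversal have equally many
  such \<open>S\<close> of each size.

  Let \<open>V\<close> be the set of vertices. Root-connectedness is detected by cuts: consider the sets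
  \<open>W \<subset> V\<close> with \<open>r \<in> W\<close> that no arc outside \<open>S\<close> leaves, that is, whose out-cut
  lies in \<open>S\<close>. If there is any such \<open>W\<close>, there is a least one, the set of vertices reachable from
  \<open>r\<close>; adding it to or removing it from a chain of such sets is a sign-reversing involution. Hence the
  sum of \<open>(-1)\<^sup>|\<^sup>C\<^sup>|\<close> over all chains \<open>C\<close> of such sets is \<open>1\<close> if \<open>arcs G - S\<close> is root-connected and
  \<open>0\<close> otherwise (\<open>root_connected_alternating_sum\<close>). Summing over \<open>S\<close> and exchanging the sums
  expresses the number of faces of size \<open>n\<close> as a signed sum, over all chains \<open>C\<close> of proper vertex
  sets containing \<open>r\<close>, of the number of \<open>n\<close>-sets of arcs that contain the union of the out-cuts of the
  members of \<open>C\<close> (\<open>card_dual_faces\<close>). That number depends only on the size of the union.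

  It remains to match the chains of \<open>G\<close> with those of the reversal. A chain is an ordered partition
  \<open>(B\<^sub>0, B\<^sub>1, \<dots>, B\<^sub>k)\<close> of \<open>V\<close> with \<open>r \<in> B\<^sub>0\<close>, its members being the unions of the proper initial
  segments, and its cut union consists of the arcs going from an earlier to a later block. Reversing
  arcs and the order of the blocks preserves this set, but puts the root block last. In an Eulerian
  digraph as many arcs leave \<open>B\<^sub>0\<close> as enter it, so moving \<open>B\<^sub>0\<close> back to the front preserves the
  number of forward arcs. Therefore \<open>(B\<^sub>0, B\<^sub>1, \<dots>, B\<^sub>k) \<mapsto> (B\<^sub>0, B\<^sub>k, \<dots>, B\<^sub>1)\<close> is an involution
  that preserves the length of the chain and the size of its cut union (\<open>flip_chain\<close>,
  \<open>card_cuts_flip_chain\<close>).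
\<close>

section \<open>Traversals and undirected cycles\<close>

text \<open>
  Walks of traversals are the walks of the underlying undirected multigraph, so they realise
  reachability in the symmetric digraph while remembering which arc is used.
\<close>

lemma arcs_ends_traversals:
  "arcs_ends (traversals F) = arcs_ends (with_proj (mk_symmetric F))"
proof -
  have "arcs_ends (traversals F) = parcs (mk_symmetric F)"
    unfolding arcs_ends_conv traversals_def parcs_mk_symmetric
    by (auto simp: image_iff ex_bool_eq split: if_splits)
  then show ?thesis by (simp add: arcs_ends_conv)
qed

lemma reachable_traversals:
  "u \<rightarrow>\<^sup>*\<^bsub>traversals F\<^esub> v \<longleftrightarrow> u \<rightarrow>\<^sup>*\<^bsub>with_proj (mk_symmetric F)\<^esub> v"
  by (simp add: reachable_def arcs_ends_traversals) (simp add: traversals_def)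

lemma wf_digraph_traversals: "wf_digraph F \<Longrightarrow> wf_digraph (traversals F)"
  by (auto simp: wf_digraph_def traversals_def)

lemma reachable_traversals_sym:
  "u \<rightarrow>\<^sup>*\<^bsub>traversals F\<^esub> v \<Longrightarrow> v \<rightarrow>\<^sup>*\<^bsub>traversals F\<^esub> u"
  using symmetric_reachable[OF symmetric_mk_symmetric] by (simp add: reachable_traversals)

lemma dominates_traversals:
  "e \<in> arcs F \<Longrightarrow> tail F e \<rightarrow>\<^bsub>traversals F\<^esub> head F e"
  "e \<in> arcs F \<Longrightarrow> head F e \<rightarrow>\<^bsub>traversals F\<^esub> tail F e"
  by (simp_all add: arcs_ends_traversals, auto simp: arcs_ends_conv parcs_mk_symmetric)

lemma wf_digraph_del_arc: "wf_digraph F \<Longrightarrow> wf_digraph (pre_digraph.del_arc F e)"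
  by (auto simp: wf_digraph_def pre_digraph.del_arc_def)

lemma reachable_imp_reachable_traversals:
  assumes "wf_digraph F" "u \<rightarrow>\<^sup>*\<^bsub>F\<^esub> v"
  shows "u \<rightarrow>\<^sup>*\<^bsub>traversals F\<^esub> v"
  using wf_digraph.reachable_mk_symmetricI[OF assms] by (simp add: reachable_traversals)

text \<open>
  Both traversals of an arc meet the same two vertices, so a path that used an arc twice would
  return to a vertex.
\<close>

lemma apath_traversals_distinct:
  assumes wf: "wf_digraph F"
    and path: "pre_digraph.apath (traversals F) u p v"
  shows "distinct (map fst p)"
  using path
proof (induction p arbitrary: u)
  case Nil
  then show ?case by simp
next
  interpret T: wf_digraph "traversals F" using wf by (rule wf_digraph_traversals)
  case (Cons t p)
  let ?x = "head (traversals F) t"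
  have t: "tail (traversals F) t = u" and p: "T.apath ?x p v"
    and u: "u \<notin> set (T.awalk_verts ?x p)"
    using Cons.prems by (auto simp: T.apath_Cons_iff)
  have "fst t \<noteq> fst s" if s: "s \<in> set p" for s
  proof
    assume eq: "fst t = fst s"
    have "tail (traversals F) s \<in> set (T.awalk_verts ?x p)"
      "head (traversals F) s \<in> set (T.awalk_verts ?x p)"
      using p s T.set_awalk_verts_not_Nil[of ?x p v]
      by (force simp: T.apath_def)+
    moreover have "u = tail (traversals F) s \<or> u = head (traversals F) s"
      using eq t[symmetric] by (cases t; cases s) (auto simp: traversals_def)
    ultimately show False using u by auto
  qed
  with Cons.IH[OF p] show ?case by auto
qed

text \<open>
  An arc whose ends stay connected after its removal closes a path to an undirected cycle.
\<close>

lemma undirected_cycle_through_arc: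
  assumes wf: "wf_digraph F" and e: "e \<in> arcs F"
    and reach: "head F e \<rightarrow>\<^sup>*\<^bsub>traversals (pre_digraph.del_arc F e)\<^esub> tail F e"
  shows "\<exists>p. undirected_cycle F p"
proof -
  let ?D = "pre_digraph.del_arc F e"
  interpret T: wf_digraph "traversals F" using wf by (rule wf_digraph_traversals)
  interpret D: wf_digraph "traversals ?D"
    using wf by (intro wf_digraph_traversals wf_digraph_del_arc)
  obtain p where p: "D.apath (head F e) p (tail F e)"
    using reach D.reachable_apath by blast
  have "compatible (traversals ?D) (traversals F)"
    by (simp add: compatible_def traversals_def pre_digraph.del_arc_def fun_eq_iff)
  then have verts: "D.awalk_verts = T.awalk_verts" and cas: "D.cas = T.cas"
    by (rule compatible_awalk_verts, rule compatible_cas)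
  have sub: "arcs (traversals ?D) = arcs (traversals F) - {e} \<times> UNIV"
    "verts (traversals ?D) = verts (traversals F)"
    by (auto simp: traversals_def pre_digraph.del_arc_def)
  have walk: "T.awalk (head F e) p (tail F e)" and e_notin: "e \<notin> fst ` set p"
    using p by (auto simp: D.apath_def D.awalk_def T.awalk_def cas sub)
  have "T.awalk (tail F e) ((e, True) # p) (tail F e)"
    using walk e by (auto simp: T.awalk_Cons_iff) (auto simp: traversals_def)
  moreover have "distinct (T.awalk_verts (head F e) p)"
    using p by (simp add: D.apath_def verts)
  then have "distinct (tl (T.awalk_verts (tail F e) ((e, True) # p)))"
    by (simp add: T.awalk_verts.simps) (simp add: traversals_def)
  ultimately have "T.cycle ((e, True) # p)"
    unfolding T.cycle_def by blast
  moreover have "distinct (map fst ((e, True) # p))"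
    using apath_traversals_distinct[OF wf_digraph_del_arc[OF wf] p] e_notin by simp
  ultimately show ?thesis unfolding undirected_cycle_def by blast
qed

section \<open>Spanning arborescences and reachability\<close>

text \<open>
  Let \<open>M\<close> be the set of vertices that directed paths from \<open>r\<close> reach. If \<open>M\<close> were not everything,
  connectedness would give an arc \<open>e\<close> between \<open>M\<close> and its complement, and \<open>e\<close> must point into \<open>M\<close>.
  A directed path from \<open>r\<close> to the head of \<open>e\<close> stays in \<open>M\<close> and hence avoids \<open>e\<close>, while the
  orientation condition connects \<open>r\<close> to the tail of \<open>e\<close> without \<open>e\<close>. So \<open>e\<close> lies on an undirected
  cycle.
\<close>

lemma arborescence_reachable:
  assumes wf: "wf_digraph F" and arb: "arborescence F r" and v: "v \<in> verts F"
  shows "r \<rightarrow>\<^sup>*\<^bsub>F\<^esub> v"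
proof (rule ccontr)
  interpret F: wf_digraph F by fact
  interpret T: wf_digraph "traversals F" using wf by (rule wf_digraph_traversals)
  assume nreach: "\<not> r \<rightarrow>\<^sup>*\<^bsub>F\<^esub> v"
  have r: "r \<in> verts F" and acyclic: "\<nexists>p. undirected_cycle F p"
    and conn: "Digraph_Component.connected F"
    and away: "\<And>e. e \<in> arcs F \<Longrightarrow> r \<rightarrow>\<^sup>*\<^bsub>traversals (pre_digraph.del_arc F e)\<^esub> tail F e"
    using arb by (auto simp: arborescence_def undirected_tree_def reachable_traversals)
  have "r \<rightarrow>\<^sup>*\<^bsub>traversals F\<^esub> v"
    using conn r v by (auto simp: connected_def strongly_connected_def reachable_traversals)
  then have "r \<rightarrow>\<^sup>*\<^bsub>F\<^esub> v \<or> (\<exists>e\<in>arcs F. r \<rightarrow>\<^sup>*\<^bsub>F\<^esub> head F e \<and> \<not> r \<rightarrow>\<^sup>*\<^bsub>F\<^esub> tail F e)"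
  proof (induction rule: T.reachable_induct)
    case base
    then show ?case using r by simp
  next
    case (step x y)
    obtain t where "t \<in> arcs (traversals F)" "tail (traversals F) t = x" "head (traversals F) t = y"
      using step.hyps by blast
    then obtain e where e: "e \<in> arcs F" "tail F e = x \<and> head F e = y \<or> head F e = x \<and> tail F e = y"
      by (cases t) (auto simp: traversals_def split: if_splits)
    have "r \<rightarrow>\<^sup>*\<^bsub>F\<^esub> tail F e \<Longrightarrow> r \<rightarrow>\<^sup>*\<^bsub>F\<^esub> head F e"
      using e(1) by (meson F.in_arcs_imp_in_arcs_ends F.reachable_adj_trans)
    with step.IH e show ?case by blast
  qed
  with nreach obtain e where e: "e \<in> arcs F" "r \<rightarrow>\<^sup>*\<^bsub>F\<^esub> head F e" "\<not> r \<rightarrow>\<^sup>*\<^bsub>F\<^esub> tail F e"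
    by blast
  let ?D = "pre_digraph.del_arc F e"
  interpret D: wf_digraph "traversals ?D"
    using wf by (intro wf_digraph_traversals wf_digraph_del_arc)
  have "r \<rightarrow>\<^sup>*\<^bsub>F\<^esub> x \<Longrightarrow> r \<rightarrow>\<^sup>*\<^bsub>traversals ?D\<^esub> x" for x
  proof (induction rule: F.reachable_induct)
    case base
    then show ?case by (intro D.reachable_refl) (simp add: traversals_def pre_digraph.del_arc_def)
  next
    case (step x y)
    then obtain a where a: "a \<in> arcs F" "tail F a = x" "head F a = y" by blast
    then have "a \<in> arcs ?D"
      using step.hyps e(3) by (auto simp: pre_digraph.del_arc_def)
    from dominates_traversals(1)[OF this] a have "x \<rightarrow>\<^bsub>traversals ?D\<^esub> y"
      by (simp add: pre_digraph.del_arc_def)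
    with step.IH show ?case by (rule D.reachable_adj_trans)
  qed
  from reachable_traversals_sym[OF this[OF e(2)]] away[OF e(1)]
  have "head F e \<rightarrow>\<^sup>*\<^bsub>traversals ?D\<^esub> tail F e" by (rule D.reachable_trans)
  with undirected_cycle_through_arc[OF wf e(1)] acyclic show False by blast
qed

text \<open>
  The next three lemmas show that a digraph has no undirected cycle if its vertices are ranked such
  that arcs go up and no two arcs share a head. An upward step into a vertex followed by a downward
  step would use two different arcs with the same head, so a trail that starts upwards stays
  upwards.
\<close>

lemma ranked_trail_ascends:
  assumes wf: "wf_digraph F"
    and rank: "\<forall>e\<in>arcs F. d (tail F e) < (d (head F e) :: nat)"
    and inj: "inj_on (head F) (arcs F)"
    and "pre_digraph.awalk (traversals F) u ((e, True) # p) v"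
    and "distinct (map fst ((e, True) # p))"
  shows "d u < d v"
  using assms(4,5)
proof (induction p arbitrary: u e)
  interpret T: wf_digraph "traversals F" using wf by (rule wf_digraph_traversals)
  case Nil
  then show ?case using rank
    by (auto simp: T.awalk_simps) (auto simp: traversals_def)
next
  interpret T: wf_digraph "traversals F" using wf by (rule wf_digraph_traversals)
  case (Cons s p)
  obtain e' b where s: "s = (e', b)" by (cases s)
  have e: "e \<in> arcs F" "e' \<in> arcs F" "e \<noteq> e'" "tail F e = u"
    and w: "T.awalk (head F e) ((e', b) # p) v"
    using Cons.prems by (auto simp: T.awalk_simps s) (auto simp: traversals_def)
  have b
  proof (rule ccontr)
    assume "\<not> b"
    with w have "head F e' = head F e" by (auto simp: T.awalk_simps) (auto simp: traversals_def)
    with inj e show False by (auto dest: inj_onD)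
  qed
  with w Cons have "d (head F e) < d v" by (simp add: s)
  with bspec[OF rank e(1)] e(4) show ?case by simp
qed

lemma awalk_reverse_traversals:
  assumes "wf_digraph F" "pre_digraph.awalk (traversals F) u p v"
  shows "pre_digraph.awalk (traversals F) v (rev (map (\<lambda>(e, b). (e, \<not> b)) p)) u"
  using assms(2)
proof (induction p arbitrary: u)
  interpret T: wf_digraph "traversals F" using assms(1) by (rule wf_digraph_traversals)
  case Nil
  then show ?case by (auto simp: T.awalk_simps)
next
  interpret T: wf_digraph "traversals F" using assms(1) by (rule wf_digraph_traversals)
  case (Cons t p)
  then have "T.awalk v (rev (map (\<lambda>(e, b). (e, \<not> b)) p)) (head (traversals F) t)"
    by (auto simp: T.awalk_simps)
  moreover have "T.awalk (head (traversals F) t) [(fst t, \<not> snd t)] u"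
    using Cons.prems wf_digraph.tail_in_verts[OF assms(1)] wf_digraph.head_in_verts[OF assms(1)]
    by (cases t) (auto simp: T.awalk_simps, auto simp: traversals_def)
  ultimately show ?case by (cases t) (auto intro: T.awalk_appendI)
qed

text \<open>
  A closed trail cannot start upwards, since it would end at a higher rank; read backwards, it
  cannot end downwards either. So it starts down and ends up, and then its first and last arc both
  have the base point as head and coincide: the same arc would be traversed in both directions.
\<close>

lemma ranked_no_undirected_cycle:
  assumes wf: "wf_digraph F"
    and rank: "\<forall>e\<in>arcs F. d (tail F e) < (d (head F e) :: nat)"
    and inj: "inj_on (head F) (arcs F)"
  shows "\<not> undirected_cycle F p"
proof
  interpret T: wf_digraph "traversals F" using wf by (rule wf_digraph_traversals)
  assume "undirected_cycle F p"
  then obtain u where w: "T.awalk u p u" and dist: "distinct (map fst p)" and "p \<noteq> []"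
    by (auto simp: undirected_cycle_def T.cycle_def)
  note no_ascent = ranked_trail_ascends[of F d, OF wf rank inj]
  obtain e b q where p: "p = (e, b) # q" using \<open>p \<noteq> []\<close> by (cases p) auto
  obtain e' b' q' where p': "p = q' @ [(e', b')]" using \<open>p \<noteq> []\<close> by (cases p rule: rev_cases) auto
  have "\<not> b" using no_ascent[of u e q u] w dist p by auto
  let ?r = "rev (map (\<lambda>(e, b). (e, \<not> b)) p)"
  have "map fst ?r = rev (map fst p)" by (simp add: rev_map case_prod_beta)
  then have "distinct (map fst ?r)" using dist by simp
  then have "b'"
    using no_ascent[of u e' "rev (map (\<lambda>(e, b). (e, \<not> b)) q')" u]
      awalk_reverse_traversals[OF wf w] p' by auto
  have "head F e = u" "e \<in> arcs F"
    using w p \<open>\<not> b\<close> by (auto simp: T.awalk_simps) (auto simp: traversals_def)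
  moreover have "head F e' = u" "e' \<in> arcs F"
    using w p' \<open>b'\<close> by (auto simp: T.awalk_simps) (auto simp: traversals_def)
  ultimately have "e = e'" using inj by (auto dest: inj_onD)
  then have "q' = []" using p p' dist by (cases q') auto
  with p p' \<open>b'\<close> \<open>\<not> b\<close> show False by auto
qed

definition root_connected :: "('a, 'b) pre_digraph \<Rightarrow> 'a \<Rightarrow> 'b set \<Rightarrow> bool" where
  "root_connected G r A \<longleftrightarrow> (\<forall>v \<in> verts G. r \<rightarrow>\<^sup>*\<^bsub>G\<lparr>arcs := A\<rparr>\<^esub> v)"

text \<open>
  The rank is the distance from \<open>r\<close>, and each vertex other than \<open>r\<close> keeps one arc that comes from a
  vertex of smaller distance.
\<close>

lemma ex_breadth_first_tree:
  assumes conn: "root_connected G r A"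
  obtains B and d :: "'a \<Rightarrow> nat" where
    "B \<subseteq> A" "inj_on (head G) B" "head G ` B = verts G - {r}"
    "\<forall>e\<in>B. d (tail G e) < d (head G e)"
proof -
  let ?R = "arcs_ends (G\<lparr>arcs := A\<rparr>)"
  define d where "d v = (LEAST n. (r, v) \<in> ?R ^^ n)" for v
  have "\<exists>e\<in>A. head G e = v \<and> d (tail G e) < d v" if v: "v \<in> verts G - {r}" for v
  proof -
    have "(r, v) \<in> ?R\<^sup>*"
      using conn v by (auto simp: root_connected_def dest: reachable_rtranclI)
    then have "(r, v) \<in> ?R ^^ d v"
      unfolding d_def by (metis LeastI_ex rtrancl_power)
    moreover from this v obtain m where m: "d v = Suc m" by (cases "d v") auto
    ultimately obtain u where u: "(r, u) \<in> ?R ^^ m" "(u, v) \<in> ?R" by auto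
    have "d u \<le> m" unfolding d_def by (rule Least_le) (rule u(1))
    then show ?thesis using u(2) m by (auto simp: arcs_ends_conv)
  qed
  then obtain par where par: "\<And>v. v \<in> verts G - {r} \<Longrightarrow>
      par v \<in> A \<and> head G (par v) = v \<and> d (tail G (par v)) < d v"
    by metis
  show thesis
  proof (rule that[of "par ` (verts G - {r})" d])
    have par_image: "e \<in> A \<and> par (head G e) = e \<and> d (tail G e) < d (head G e)"
      if e: "e \<in> par ` (verts G - {r})" for e
    proof -
      obtain v where "v \<in> verts G - {r}" "e = par v" using e by blast
      then show ?thesis using par[of v] by simp
    qed
    then show "par ` (verts G - {r}) \<subseteq> A" "inj_on (head G) (par ` (verts G - {r}))"
      by (blast, intro inj_on_inverseI[where g = par]) blast
    show "\<forall>e \<in> par ` (verts G - {r}). d (tail G e) < d (head G e)"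
      using par_image by blast
    have "(\<lambda>v. head G (par v)) ` (verts G - {r}) = (\<lambda>v. v) ` (verts G - {r})"
      by (rule image_cong) (use par in auto)
    then show "head G ` par ` (verts G - {r}) = verts G - {r}"
      by (simp add: image_image)
  qed
qed

text \<open>
  The path to \<open>v\<close> found by going back along parent arcs only uses arcs whose heads rank at most as
  high as \<open>v\<close>. It therefore survives the deletion of an arc \<open>e\<close> with tail \<open>v\<close>, whose head ranks
  higher; this gives the orientation condition for arborescences.
\<close>

lemma ranked_reachable:
  assumes wf: "wf_digraph F" and r: "r \<in> verts F"
    and heads: "head F ` arcs F = verts F - {r}"
    and rank: "\<forall>e\<in>arcs F. d (tail F e) < (d (head F e) :: nat)"
    and H: "wf_digraph H" "compatible F H" "verts H = verts F"
    and "v \<in> verts F"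
    and "\<And>e. e \<in> arcs F \<Longrightarrow> d (head F e) \<le> d v \<Longrightarrow> e \<in> arcs H"
  shows "r \<rightarrow>\<^sup>*\<^bsub>H\<^esub> v"
  using assms(8,9)
proof (induction "d v" arbitrary: v rule: less_induct)
  interpret F: wf_digraph F by fact
  interpret H: wf_digraph H by fact
  case less
  show ?case
  proof (cases "v = r")
    case True
    have "r \<rightarrow>\<^sup>*\<^bsub>H\<^esub> r" using r H(3) by simp
    with True show ?thesis by simp
  next
    case False
    then have "v \<in> head F ` arcs F" using heads less.prems(1) by blast
    then obtain e where e: "e \<in> arcs F" "head F e = v" by blast
    have "r \<rightarrow>\<^sup>*\<^bsub>H\<^esub> tail F e"
    proof (rule less.hyps)
      show "d (tail F e) < d v" using bspec[OF rank e(1)] e(2) by simp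
      show "tail F e \<in> verts F" using e(1) by simp
      show "a \<in> arcs H" if "a \<in> arcs F" "d (head F a) \<le> d (tail F e)" for a
        by (rule less.prems(2)) (use that bspec[OF rank e(1)] e(2) in auto)
    qed
    moreover have "tail H e \<rightarrow>\<^bsub>H\<^esub> head H e"
      using less.prems(2)[OF e(1)] e(2) by (auto simp: arcs_ends_conv)
    ultimately show ?thesis
      using e(2) H(2) H.reachable_adj_trans by (metis compatible_head compatible_tail)
  qed
qed

lemma ranked_arborescence:
  assumes wf: "wf_digraph F" and r: "r \<in> verts F"
    and heads: "head F ` arcs F = verts F - {r}"
    and rank: "\<forall>e\<in>arcs F. d (tail F e) < (d (head F e) :: nat)"
    and inj: "inj_on (head F) (arcs F)"
  shows "arborescence F r"
proof -
  interpret F: wf_digraph F by fact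
  interpret T: wf_digraph "traversals F" using wf by (rule wf_digraph_traversals)
  note reach = ranked_reachable[of F r d, OF wf r heads rank]
  have "r \<rightarrow>\<^sup>*\<^bsub>traversals F\<^esub> v" if "v \<in> verts F" for v
    by (rule reachable_imp_reachable_traversals[OF wf], rule reach)
      (use wf that in \<open>auto simp: compatible_def\<close>)
  then have "Digraph_Component.connected F"
    unfolding connected_def strongly_connected_def
    using r by (auto simp flip: reachable_traversals
        intro: T.reachable_trans reachable_traversals_sym)
  moreover have "r \<rightarrow>\<^sup>*\<^bsub>traversals (pre_digraph.del_arc F e)\<^esub> tail F e" if e: "e \<in> arcs F" for e
    by (rule reachable_imp_reachable_traversals[OF wf_digraph_del_arc[OF wf]],
        rule reach)
      (use e wf_digraph_del_arc[OF wf, of e] bspec[OF rank e] wf_digraph.tail_in_verts[OF wf e] in \<open>auto simp: compatible_def pre_digraph.del_arc_def\<close>)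
  ultimately show ?thesis
    using r ranked_no_undirected_cycle[of F d, OF wf rank inj]
    unfolding arborescence_def undirected_tree_def reachable_traversals by blast
qed

lemma ex_base_iff_root_connected:
  assumes wf: "wf_digraph G" and r: "r \<in> verts G" and A: "A \<subseteq> arcs G"
  shows "(\<exists>B \<in> branching_bases G r. B \<subseteq> A) \<longleftrightarrow> root_connected G r A"
proof
  assume "\<exists>B \<in> branching_bases G r. B \<subseteq> A"
  then obtain F where F: "spanning F G" "arborescence F r" "arcs F \<subseteq> A"
    by (auto simp: branching_bases_def)
  then have wfF: "wf_digraph F" and V: "verts F = verts G" and c: "compatible G F"
    by (auto simp: spanning_def subgraph_def)
  have "arcs_ends F \<subseteq> arcs_ends (G\<lparr>arcs := A\<rparr>)"
    using F(3) c by (auto simp: arcs_ends_conv compatible_def)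
  then show "root_connected G r A"
    using arborescence_reachable[OF wfF F(2)] V
    unfolding root_connected_def reachable_def by (auto intro: rtrancl_on_mono)
next
  assume conn: "root_connected G r A"
  obtain B d where B: "B \<subseteq> A" "inj_on (head G) B" "head G ` B = verts G - {r}"
    "\<forall>e\<in>B. d (tail G e) < (d (head G e) :: nat)"
    by (rule ex_breadth_first_tree[OF conn])
  let ?F = "G\<lparr>arcs := B\<rparr>"
  have wfF: "wf_digraph ?F" using wf B(1) A by (auto simp: wf_digraph_def)
  have "arborescence ?F r"
    by (rule ranked_arborescence[where d = d]) (use wfF r B in auto)
  moreover have "spanning ?F G"
    using wf wfF B(1) A by (auto simp: spanning_def subgraph_def compatible_def)
  ultimately have "B \<in> branching_bases G r"
    unfolding branching_bases_def by (auto intro!: exI[of _ ?F])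
  with B(1) show "\<exists>B \<in> branching_bases G r. B \<subseteq> A" by blast
qed

section \<open>Root-connected sets as alternating sums over chains\<close>

definition out_cut :: "('a, 'b) pre_digraph \<Rightarrow> 'a set \<Rightarrow> 'b set" where
  "out_cut G W = {e \<in> arcs G. tail G e \<in> W \<and> head G e \<notin> W}"

text \<open>
  In terms of ordered partitions of the vertices, a chain lists the unions of the proper initial
  segments of blocks. The full vertex set is left out, so the empty chain is the partition into a
  single block.
\<close>

definition root_chains :: "('a, 'b) pre_digraph \<Rightarrow> 'a \<Rightarrow> 'a set set set" where
  "root_chains G r =
     {C. C \<subseteq> Pow (verts G) - {verts G} \<and> (\<forall>W \<in> C. r \<in> W) \<and> chain_subset C}"

lemma finite_root_chains: "finite (verts G) \<Longrightarrow> finite (root_chains G r)"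
  by (rule finite_subset[of _ "Pow (Pow (verts G))"]) (auto simp: root_chains_def)

lemma root_chains_finite:
  "finite (verts G) \<Longrightarrow> C \<in> root_chains G r \<Longrightarrow> finite C"
  by (auto simp: root_chains_def intro: finite_subset[of _ "Pow (verts G)"])

lemma alternating_sum_toggle:
  assumes "finite X" and X: "\<And>C. C \<in> X \<Longrightarrow> finite C"
    and "\<And>C. C \<in> X \<Longrightarrow> insert M C \<in> X" "\<And>C. C \<in> X \<Longrightarrow> C - {M} \<in> X"
  shows "(\<Sum>C\<in>X. (- 1) ^ card C) = (0 :: int)"
proof -
  have "(\<Sum>C\<in>X. (- 1) ^ card C) =
      (\<Sum>C\<in>{C\<in>X. M \<in> C}. (- 1) ^ card C) + (\<Sum>C\<in>{C\<in>X. M \<notin> C}. (- 1 :: int) ^ card C)"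
    using \<open>finite X\<close> by (subst sum.union_disjoint[symmetric]) (auto intro: sum.cong)
  also have "(\<Sum>C\<in>{C\<in>X. M \<in> C}. (- 1) ^ card C) = (\<Sum>C\<in>{C\<in>X. M \<notin> C}. - ((- 1 :: int) ^ card C))"
  proof (rule sum.reindex_bij_witness[of _ "insert M" "\<lambda>C. C - {M}"])
    fix C assume C: "C \<in> {C \<in> X. M \<in> C}"
    then have "card C = Suc (card (C - {M}))" using X by (intro card.remove) auto
    then show "- ((- 1 :: int) ^ card (C - {M})) = (- 1) ^ card C"
      by (simp only: power_Suc)
  qed (use assms in \<open>auto simp: insert_absorb\<close>)
  finally show ?thesis by (simp add: sum_negf)
qed

text \<open>
  The sets \<open>W\<close> whose out-cut lies in \<open>S\<close> are those that are closed under the arcs outside \<open>S\<close>. The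
  set \<open>M\<close> reachable from \<open>r\<close> is the least of them that contains \<open>r\<close>. If \<open>M\<close> is the full vertex
  set, the empty chain is the only one; otherwise toggling \<open>M\<close> cancels all chains in pairs.
\<close>

lemma root_connected_alternating_sum:
  assumes fin: "fin_digraph G" and r: "r \<in> verts G"
  shows "(\<Sum>C | C \<in> root_chains G r \<and> (\<Union>W\<in>C. out_cut G W) \<subseteq> S. (- 1) ^ card C)
    = (if root_connected G r (arcs G - S) then 1 else 0 :: int)"
proof -
  interpret G: fin_digraph G by fact
  let ?H = "G\<lparr>arcs := arcs G - S\<rparr>"
  let ?X = "{C. C \<in> root_chains G r \<and> (\<Union>W\<in>C. out_cut G W) \<subseteq> S}"
  interpret H: wf_digraph ?H using G.wf_digraph by (auto simp: wf_digraph_def)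
  define M where "M = {v. r \<rightarrow>\<^sup>*\<^bsub>?H\<^esub> v}"
  have rM: "r \<in> M" using r by (simp add: M_def)
  have MV: "M \<subseteq> verts G" using H.reachable_in_verts by (auto simp: M_def)
  have Mcut: "out_cut G M \<subseteq> S"
  proof
    fix e assume e: "e \<in> out_cut G M"
    show "e \<in> S"
    proof (rule ccontr)
      assume "e \<notin> S"
      then have "e \<in> arcs ?H" using e by (simp add: out_cut_def)
      then have "tail G e \<rightarrow>\<^bsub>?H\<^esub> head G e" by (auto simp: arcs_ends_conv)
      with e show False by (auto simp: M_def out_cut_def intro: H.reachable_adj_trans)
    qed
  qed
  have least: "M \<subseteq> W" if "r \<in> W" "out_cut G W \<subseteq> S" for W
  proof -
    have "x \<in> W" if "r \<rightarrow>\<^sup>*\<^bsub>?H\<^esub> x" for x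
      using that
    proof (induction rule: H.reachable_induct)
      case (step x y)
      then obtain e where "e \<in> arcs ?H" "tail ?H e = x" "head ?H e = y" by blast
      with step.IH \<open>out_cut G W \<subseteq> S\<close> show ?case by (auto simp: out_cut_def)
    qed (use \<open>r \<in> W\<close> in simp)
    then show ?thesis by (auto simp: M_def)
  qed
  have conn: "root_connected G r (arcs G - S) \<longleftrightarrow> M = verts G"
    using MV by (auto simp: root_connected_def M_def)
  have finX: "finite ?X" "\<And>C. C \<in> ?X \<Longrightarrow> finite C"
    using finite_root_chains[OF G.finite_verts]
    by (auto simp: intro: root_chains_finite[OF G.finite_verts])
  show ?thesis
  proof (cases "M = verts G")
    case True
    have "?X = {{}}"
    proof (intro equalityI subsetI)
      fix C assume C: "C \<in> ?X"
      have "W \<notin> C" for W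
        using least[of W] C True by (auto simp: root_chains_def)
      then show "C \<in> {{}}" by auto
    qed (auto simp: root_chains_def chain_subset_def)
    then show ?thesis using True conn by simp
  next
    case False
    have "(\<Sum>C\<in>?X. (- 1) ^ card C) = (0 :: int)"
    proof (rule alternating_sum_toggle[where M = M])
      fix C assume C: "C \<in> ?X"
      have "M \<subseteq> W" if "W \<in> C" for W
        using C that by (intro least) (auto simp: root_chains_def)
      then show "insert M C \<in> ?X"
        using C rM MV Mcut False by (auto simp: root_chains_def chain_subset_def)
      show "C - {M} \<in> ?X" using C by (auto simp: root_chains_def chain_subset_def)
    qed (use finX in auto)
    then show ?thesis using False conn by simp
  qed
qed

lemma card_supersets_eq:
  assumes "finite E" "F \<subseteq> E" "F' \<subseteq> E" "card F = card F'"
  shows "card {S. S \<subseteq> E \<and> F \<subseteq> S \<and> card S = n} = card {S. S \<subseteq> E \<and> F' \<subseteq> S \<and> card S = n}"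
proof -
  have aux: "card {S. S \<subseteq> E \<and> F \<subseteq> S \<and> card S = n} = card {T. T \<subseteq> E - F \<and> card F + card T = n}"
    if "F \<subseteq> E" for F
  proof (rule bij_betw_same_card)
    have fin: "finite F" using that assms(1) finite_subset by blast
    have card: "card (F \<union> T) = card F + card T" if "T \<subseteq> E - F" for T
      using that fin assms(1) by (intro card_Un_disjoint) (auto intro: finite_subset)
    show "bij_betw (\<lambda>S. S - F) {S. S \<subseteq> E \<and> F \<subseteq> S \<and> card S = n} {T. T \<subseteq> E - F \<and> card F + card T = n}"
    proof (rule bij_betw_byWitness[where f' = "\<lambda>T. F \<union> T"])
      show "(\<lambda>S. S - F) ` {S. S \<subseteq> E \<and> F \<subseteq> S \<and> card S = n} \<subseteq> {T. T \<subseteq> E - F \<and> card F + card T = n}"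
      proof (clarify, intro conjI)
        fix S assume S: "S \<subseteq> E" "F \<subseteq> S"
        then show "S - F \<subseteq> E - F" by auto
        with card[of "S - F"] S show "card F + card (S - F) = card S"
          by (simp add: Un_absorb1 Un_Diff_cancel)
      qed
      show "(\<union>) F ` {T. T \<subseteq> E - F \<and> card F + card T = n} \<subseteq> {S. S \<subseteq> E \<and> F \<subseteq> S \<and> card S = n}"
        using that by (auto simp: card)
    qed auto
  qed
  have "card {T. T \<subseteq> E - F \<and> card F + card T = n} = card {T. T \<subseteq> E - F' \<and> card F' + card T = n}"
  proof -
    have fin: "finite F" "finite F'" using assms finite_subset by blast+
    have "card (E - F) = card (E - F')" using assms fin by (simp add: card_Diff_subset)
    then show ?thesis
    proof (cases "card F \<le> n")
      case True
      then have "{T. T \<subseteq> E - F \<and> card F + card T = n} = {T. T \<subseteq> E - F \<and> card T = n - card F}"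
        "{T. T \<subseteq> E - F' \<and> card F' + card T = n} = {T. T \<subseteq> E - F' \<and> card T = n - card F}"
        using assms(4) by auto
      then show ?thesis using \<open>card (E - F) = card (E - F')\<close> assms(1) by (simp add: n_subsets)
    next
      case False
      then show ?thesis using assms(4) by simp
    qed
  qed
  with aux[OF assms(2)] aux[OF assms(3)] show ?thesis by simp
qed

text \<open>
  Exchange the sum over the \<open>n\<close>-sets \<open>S\<close> with the alternating sum that decides whether \<open>S\<close> is a face.
\<close>

lemma card_dual_faces:
  assumes fin: "fin_digraph G" and r: "r \<in> verts G"
  shows "int (card {S \<in> dual_complex (arcs G) (branching_bases G r). card S = n}) =
    (\<Sum>C \<in> root_chains G r. (- 1) ^ card C *
       int (card {S. S \<subseteq> arcs G \<and> (\<Union>W\<in>C. out_cut G W) \<subseteq> S \<and> card S = n}))"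
proof -
  interpret G: fin_digraph G by fact
  let ?P = "{S. S \<subseteq> arcs G \<and> card S = n}"
  let ?F = "\<lambda>C. \<Union>W\<in>C. out_cut G W"
  have finP: "finite ?P" by (rule finite_subset[of _ "Pow (arcs G)"]) auto
  note finC = finite_root_chains[OF G.finite_verts, of r]
  have "{S \<in> dual_complex (arcs G) (branching_bases G r). card S = n} =
      {S \<in> ?P. root_connected G r (arcs G - S)}"
    using ex_base_iff_root_connected[OF G.wf_digraph r]
    by (auto simp: dual_complex_def)
  then have "int (card {S \<in> dual_complex (arcs G) (branching_bases G r). card S = n}) =
      (\<Sum>S\<in>?P. if root_connected G r (arcs G - S) then 1 else 0)"
    using finP by (simp add: sum.If_cases Int_def)
  also have "\<dots> = (\<Sum>S\<in>?P. \<Sum>C | C \<in> root_chains G r \<and> ?F C \<subseteq> S. (- 1) ^ card C)"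
    by (simp only: root_connected_alternating_sum[OF fin r])
  also have "\<dots> = (\<Sum>C\<in>root_chains G r. \<Sum>S | S \<in> ?P \<and> ?F C \<subseteq> S. (- 1) ^ card C)"
    by (rule sum.swap_restrict[OF finP finC])
  also have "\<dots> = (\<Sum>C\<in>root_chains G r. (- 1) ^ card C *
       int (card {S. S \<subseteq> arcs G \<and> ?F C \<subseteq> S \<and> card S = n}))"
    by (intro sum.cong refl) (simp add: mult.commute conj_ac)
  finally show ?thesis .
qed

section \<open>Reversal of chains\<close>

text \<open>
  Summed over \<open>W\<close>, the out-degrees count the arcs leaving \<open>W\<close> and those inside, and the in-degrees
  count the arcs entering \<open>W\<close> and those inside.
\<close>

lemma eulerian_cut_balance:
  assumes fin: "fin_digraph G" and eul: "eulerian G" and W: "W \<subseteq> verts G"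
  shows "card (out_cut G W) = card (out_cut (reverse_digraph G) W)"
proof -
  interpret G: fin_digraph G by fact
  have finW: "finite W" using W by (rule finite_subset) simp
  let ?I = "{e \<in> arcs G. tail G e \<in> W \<and> head G e \<in> W}"
  have "card (out_cut G W) + card ?I = card (\<Union>v\<in>W. out_arcs G v)"
    by (subst card_Un_disjoint[symmetric])
      (auto simp: out_cut_def intro: arg_cong[where f = card])
  also have "\<dots> = (\<Sum>v\<in>W. out_degree G v)"
    unfolding out_degree_def using finW by (intro card_UN_disjoint) auto
  also have "\<dots> = (\<Sum>v\<in>W. in_degree G v)"
    using eul W by (intro sum.cong) (auto simp: eulerian_def)
  also have "\<dots> = card (\<Union>v\<in>W. in_arcs G v)"
    unfolding in_degree_def using finW by (intro card_UN_disjoint[symmetric]) auto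
  also have "\<dots> = card (out_cut (reverse_digraph G) W) + card ?I"
    by (subst card_Un_disjoint[symmetric])
      (auto simp: out_cut_def reverse_digraph_def intro: arg_cong[where f = card])
  finally show ?thesis by simp
qed

text \<open>
  For a chain with blocks \<open>(B\<^sub>0, B\<^sub>1, \<dots>, B\<^sub>k)\<close> the intersection of its members is \<open>B\<^sub>0\<close>, and
  \<open>B\<^sub>0 \<union> (V - W)\<close> turns the initial segment up to \<open>B\<^sub>i\<close> into \<open>B\<^sub>0\<close> and the blocks after \<open>B\<^sub>i\<close>. So
  this is the chain of \<open>(B\<^sub>0, B\<^sub>k, \<dots>, B\<^sub>1)\<close>.
\<close>

definition flip_chain :: "'a set \<Rightarrow> 'a set set \<Rightarrow> 'a set set" where
  "flip_chain V C = (\<lambda>W. if W = \<Inter>C then W else \<Inter>C \<union> (V - W)) ` C"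

lemma Inter_in_chain:
  assumes "finite C" "C \<noteq> {}" "chain_subset C"
  shows "\<Inter>C \<in> C"
  using assms
proof (induction C rule: finite_ne_induct)
  case (insert W C)
  then have "\<Inter>C \<in> C" by (auto simp: chain_subset_def)
  then have "W \<subseteq> \<Inter>C \<or> \<Inter>C \<subseteq> W" using insert.prems by (auto simp: chain_subset_def)
  with \<open>\<Inter>C \<in> C\<close> show ?case by (auto simp: inf_absorb1 inf_absorb2)
qed simp

text \<open>
  Every member \<open>W\<close> contains \<open>B = \<Inter>C\<close>, so \<open>B \<union> (V - (B \<union> (V - W))) = W\<close>; and if \<open>W \<noteq> B\<close>, the
  image omits the elements of \<open>W - B\<close> and is again proper. The intersection of the members does not
  change, so flipping twice applies the same map to the members twice.
\<close>

lemma flip_chain: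
  assumes fin: "finite (verts G)" and C: "C \<in> root_chains G r"
  shows "flip_chain (verts G) C \<in> root_chains G r"
    and "flip_chain (verts G) (flip_chain (verts G) C) = C"
    and "card (flip_chain (verts G) C) = card C"
proof -
  let ?V = "verts G" and ?B = "\<Inter>C"
  let ?D = "flip_chain ?V C"
  let ?f = "\<lambda>W. if W = ?B then W else ?B \<union> (?V - W)"
  have "?D \<in> root_chains G r \<and> flip_chain ?V ?D = C \<and> card ?D = card C"
  proof (cases "C = {}")
    case True
    then show ?thesis using C by (simp add: flip_chain_def)
  next
    case False
    have CV: "\<And>W. W \<in> C \<Longrightarrow> W \<subset> ?V" and Cr: "\<And>W. W \<in> C \<Longrightarrow> r \<in> W" and chain: "chain_subset C"
      using C by (auto simp: root_chains_def)
    have B: "?B \<in> C" using Inter_in_chain[OF root_chains_finite[OF fin C] False chain] .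
    have sub: "\<And>W. W \<in> C \<Longrightarrow> ?B \<subseteq> W" by auto
    define f where "f = ?f"
    have D: "?D = f ` C" by (simp add: flip_chain_def f_def)
    have inv: "f (f W) = W" if "W \<in> C" for W
      unfolding f_def using CV[OF that] sub[OF that] by auto
    have "inj_on f C" by (rule inj_on_inverseI[where g = f]) (rule inv)
    then have "card ?D = card C" unfolding D by (rule card_image)
    moreover have "\<Inter>?D = ?B"
    proof
      have "f ?B \<in> ?D" unfolding D using B by (rule imageI)
      then show "\<Inter>?D \<subseteq> ?B" by (auto simp: f_def)
      show "?B \<subseteq> \<Inter>?D" unfolding D f_def by (auto split: if_splits)
    qed
    then have flip_D: "flip_chain ?V ?D = f ` ?D"
      by (simp only: flip_chain_def[of ?V ?D] f_def)
    have "f ` ?D = (\<lambda>W. W) ` C"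
      unfolding D image_image by (rule image_cong[OF refl inv])
    with flip_D have "flip_chain ?V ?D = C" by simp
    moreover have "?D \<in> root_chains G r"
    proof -
      have "f W \<subset> ?V" "r \<in> f W" if "W \<in> C" for W
        using CV[OF that] sub[OF that] CV[OF B] Cr[OF B] by (auto simp: f_def)
      moreover have "f W \<subseteq> f W' \<or> f W' \<subseteq> f W" if "W \<in> C" "W' \<in> C" for W W'
        using chain that sub unfolding f_def chain_subset_def by (auto split: if_splits)
      ultimately show ?thesis unfolding root_chains_def chain_subset_def D by blast
    qed
    ultimately show ?thesis by blast
  qed
  then show "?D \<in> root_chains G r" "flip_chain ?V ?D = C" "card ?D = card C" by auto
qed

text \<open>
  Split the cut union of a chain into the arcs between \<open>B = \<Inter>C\<close> and its complement, and the arcs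
  that run from an earlier to a later block outside \<open>B\<close>. The latter are the same set \<open>K\<close> for \<open>C\<close> in
  \<open>G\<close> and the flipped chain in the reversal, since arcs and blocks are both reversed. The former are
  the arcs of \<open>G\<close> leaving \<open>B\<close> in the one case and those entering \<open>B\<close> in the other, equally many.
\<close>

lemma card_cuts_flip_chain:
  assumes fin: "fin_digraph G" and eul: "eulerian G" and C: "C \<in> root_chains G r"
  shows "card (\<Union>W\<in>C. out_cut G W) =
    card (\<Union>W\<in>flip_chain (verts G) C. out_cut (reverse_digraph G) W)"
proof (cases "C = {}")
  case True
  then show ?thesis by (simp add: flip_chain_def)
next
  interpret G: fin_digraph G by fact
  case False
  let ?V = "verts G" and ?B = "\<Inter>C"
  have CV: "\<And>W. W \<in> C \<Longrightarrow> W \<subset> ?V" and chain: "chain_subset C"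
    using C by (auto simp: root_chains_def)
  have B: "?B \<in> C"
    using Inter_in_chain[OF root_chains_finite[OF G.finite_verts C] False chain] .
  have BV: "?B \<subseteq> ?V" using CV[OF B] by auto
  \<comment> \<open>The arcs of \<open>G\<close> going from one block outside \<open>?B\<close> to a later one: the head of such an arc
    is outside some \<open>W \<in> C\<close>, hence outside \<open>?B\<close>.\<close>
  define K where "K = {e \<in> arcs G. tail G e \<notin> ?B \<and> (\<exists>W\<in>C. tail G e \<in> W \<and> head G e \<notin> W)}"
  have finK: "finite K" by (simp add: K_def)
  have "(\<Union>W\<in>C. out_cut G W) = out_cut G ?B \<union> K"
    using B by (auto simp: out_cut_def K_def)
  moreover have "out_cut G ?B \<inter> K = {}" by (auto simp: out_cut_def K_def)
  ultimately have 1: "card (\<Union>W\<in>C. out_cut G W) = card (out_cut G ?B) + card K"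
    using finK by (simp add: card_Un_disjoint out_cut_def)
  have "(\<Union>W\<in>flip_chain ?V C. out_cut (reverse_digraph G) W)
      = out_cut (reverse_digraph G) ?B \<union> K" (is "?L = ?R")
  proof
    show "?L \<subseteq> ?R"
      by (auto simp: flip_chain_def out_cut_def reverse_digraph_def K_def split: if_splits)
    show "?R \<subseteq> ?L"
    proof
      fix e assume "e \<in> ?R"
      then consider "e \<in> out_cut (reverse_digraph G) ?B" | "e \<in> K" by blast
      then show "e \<in> ?L"
      proof cases
        case 1
        with B show ?thesis by (force simp: flip_chain_def)
      next
        case 2
        then obtain W where W: "e \<in> arcs G" "tail G e \<notin> ?B" "W \<in> C" "tail G e \<in> W" "head G e \<notin> W"
          by (auto simp: K_def)
        then have "W \<noteq> ?B" "head G e \<notin> ?B" by auto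
        then have "e \<in> out_cut (reverse_digraph G) (?B \<union> (?V - W))"
          using W by (auto simp: out_cut_def reverse_digraph_def)
        moreover have "?B \<union> (?V - W) \<in> flip_chain ?V C"
          unfolding flip_chain_def using \<open>W \<in> C\<close> \<open>W \<noteq> ?B\<close> by (intro image_eqI[of _ _ W]) auto
        ultimately show ?thesis by blast
      qed
    qed
  qed
  moreover have "out_cut (reverse_digraph G) ?B \<inter> K = {}"
    by (auto simp: out_cut_def reverse_digraph_def K_def)
  ultimately have 2: "card (\<Union>W\<in>flip_chain ?V C. out_cut (reverse_digraph G) W) =
      card (out_cut (reverse_digraph G) ?B) + card K"
    using finK by (simp add: card_Un_disjoint out_cut_def reverse_digraph_def)
  show ?thesis using 1 2 eulerian_cut_balance[OF fin eul BV] by simp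
qed

lemma card_dual_faces_reverse:
  assumes fin: "fin_digraph G" and eul: "eulerian G" and r: "r \<in> verts G"
  shows "card {S \<in> dual_complex (arcs G) (branching_bases G r). card S = n} =
    card {S \<in> dual_complex (arcs (reverse_digraph G)) (branching_bases (reverse_digraph G) r). card S = n}"
proof -
  interpret G: fin_digraph G by fact
  let ?R = "reverse_digraph G" and ?V = "verts G"
  have chains: "root_chains ?R r = root_chains G r"
    and arcs: "arcs ?R = arcs G" and r': "r \<in> verts ?R"
    using r by (simp_all add: root_chains_def reverse_digraph_def)
  have "(\<Sum>C \<in> root_chains G r. (- 1) ^ card C *
       int (card {S. S \<subseteq> arcs G \<and> (\<Union>W\<in>C. out_cut G W) \<subseteq> S \<and> card S = n})) =
     (\<Sum>C \<in> root_chains ?R r. (- 1) ^ card C *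
       int (card {S. S \<subseteq> arcs ?R \<and> (\<Union>W\<in>C. out_cut ?R W) \<subseteq> S \<and> card S = n}))"
    unfolding chains
  proof (rule sum.reindex_bij_witness[of _ "flip_chain ?V" "flip_chain ?V"])
    fix C assume C: "C \<in> root_chains G r"
    have "card {S. S \<subseteq> arcs G \<and> (\<Union>W\<in>C. out_cut G W) \<subseteq> S \<and> card S = n} =
      card {S. S \<subseteq> arcs G \<and> (\<Union>W\<in>flip_chain ?V C. out_cut ?R W) \<subseteq> S \<and> card S = n}"
      by (rule card_supersets_eq)
        (use card_cuts_flip_chain[OF fin eul C] in \<open>auto simp: out_cut_def reverse_digraph_def\<close>)
    then show "(- 1) ^ card (flip_chain ?V C) *
       int (card {S. S \<subseteq> arcs ?R \<and> (\<Union>W\<in>flip_chain ?V C. out_cut ?R W) \<subseteq> S \<and> card S = n}) =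
      (- 1) ^ card C *
       int (card {S. S \<subseteq> arcs G \<and> (\<Union>W\<in>C. out_cut G W) \<subseteq> S \<and> card S = n})"
      using flip_chain(3)[OF G.finite_verts C] arcs by simp
  qed (use flip_chain[OF G.finite_verts] in auto)
  then have "int (card {S \<in> dual_complex (arcs G) (branching_bases G r). card S = n}) =
    int (card {S \<in> dual_complex (arcs ?R) (branching_bases ?R r). card S = n})"
    using card_dual_faces[OF fin r] card_dual_faces[OF fin_digraph_reverse_digraph[OF fin] r']
    by simp
  then show ?thesis by simp
qed

section \<open>The h-polynomial\<close>

text \<open>
  The sizes that occur determine the dimension, and each face contributes to the \<open>f\<close>-polynomial a
  term that depends only on its size and the dimension.
\<close>

lemma h_poly_cong_card:
  fixes \<S> \<T> :: "'a set set"
  assumes fin: "finite \<S>" "finite \<T>"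
    and eq: "\<And>n. card {S \<in> \<S>. card S = n} = card {S \<in> \<T>. card S = n}"
  shows "h_poly \<S> = h_poly \<T>"
proof -
  have "n \<in> card ` \<S> \<longleftrightarrow> card {S \<in> \<S>. card S = n} \<noteq> 0"
    "n \<in> card ` \<T> \<longleftrightarrow> card {S \<in> \<T>. card S = n} \<noteq> 0" for n
    using fin by auto
  with eq have cards: "card ` \<S> = card ` \<T>" by (intro set_eqI) (simp only:)
  have "simplex_dim ` \<U> = (\<lambda>n. int n - 1) ` card ` \<U>" for \<U> :: "'a set set"
    by (auto simp: simplex_dim_def)
  then have dim: "complex_dim \<S> = complex_dim \<T>"
    unfolding complex_dim_def by (simp only: cards)
  define w :: "nat \<Rightarrow> int poly" where "w n = monom 1 (nat (complex_dim \<S> - (int n - 1)))" for n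
  have group: "(\<Sum>S\<in>\<U>. w (card S)) = (\<Sum>n\<in>card ` \<U>. of_nat (card {S \<in> \<U>. card S = n}) * w n)"
    if "finite \<U>" for \<U> :: "'a set set"
  proof -
    have "(\<Sum>S\<in>\<U>. w (card S)) = (\<Sum>n\<in>card ` \<U>. \<Sum>S\<in>{S \<in> \<U>. card S = n}. w (card S))"
      by (rule sum.image_gen[OF that])
    also have "\<dots> = (\<Sum>n\<in>card ` \<U>. of_nat (card {S \<in> \<U>. card S = n}) * w n)"
      by (rule sum.cong) simp_all
    finally show ?thesis .
  qed
  have "f_poly \<S> = (\<Sum>S\<in>\<S>. w (card S))" "f_poly \<T> = (\<Sum>S\<in>\<T>. w (card S))"
    unfolding f_poly_def simplex_dim_def w_def dim by (rule refl)+
  then have "f_poly \<S> = f_poly \<T>"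
    by (simp only: group[OF fin(1)] group[OF fin(2)] cards eq)
  then show ?thesis by (simp add: h_poly_def)
qed

theorem theorem4p9:
  fixes G :: "('a, 'b) pre_digraph" and v\<^sub>0 :: 'a
  assumes "fin_digraph G"
    and "Digraph_Component.connected G"
    and "eulerian G"
    and "v\<^sub>0 \<in> verts G"
  shows "greedoid_poly G v\<^sub>0 = greedoid_poly (reverse_digraph G) v\<^sub>0"
  unfolding greedoid_poly_def
proof (rule h_poly_cong_card)
  have finite: "finite (dual_complex (arcs G) \<B>)" for \<B> :: "'b set set"
    using fin_digraph.finite_arcs[OF assms(1)]
    by (auto simp: dual_complex_def intro: finite_subset[of _ "Pow (arcs G)"])
  show "finite (dual_complex (arcs G) (branching_bases G v\<^sub>0))"
    by (rule finite)
  show "finite (dual_complex (arcs (reverse_digraph G)) (branching_bases (reverse_digraph G) v\<^sub>0))"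
    using finite by (simp add: reverse_digraph_def)
qed (rule card_dual_faces_reverse[OF assms(1,3,4)])

end
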